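(* Let $R=(r_1,\ldots,r_m)$ and $S=(s_1,\ldots,s_n)$ be monotone nonincreasing, nonnegative integral vectors such that $\mathcal{A}(R,S)$ is nonempty. Let $t$ be a positive integer. Then \[\overline{\rho_t}(R,S)=\min\{t_{ef}(R,S)+te+f: 0\le e\le m,\ 0\le f\le n\}.\]
   Context: $\mathcal{A}(R,S)$ is the class of all $m\times n$ $(0,1)$-matrices with row sum vector $R$ and column sum vector $S$. For $0\le e\le m$, $0\le f\le n$, $t_{ef}(R,S)=ef-\sum_{j=1}^f s_j+\sum_{i=e+1}^m r_i$. For a $(0,1)$-matrix $A$ and positive integer $t$, the $t$-term rank $\rho_t(A)$ is the maximum number of $1$s of $A$ that can be chosen with at most one chosen $1$ in each column and at most $t$ chosen $1$s in each row. $\overline{\rho_t}(R,S)$ denotes the maximum of $\rho_t(A)$ over $A\in\mathcal{A}(R,S)$. *)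

theory Defs
  imports "Jordan_Normal_Form.Matrix"
begin

definition row_sum_vec :: "nat mat \<Rightarrow> nat vec" where
  "row_sum_vec A = vec (dim_row A) (\<lambda>i. \<Sum>j<dim_col A. A $$ (i, j))"

definition col_sum_vec :: "nat mat \<Rightarrow> nat vec" where
  "col_sum_vec A = vec (dim_col A) (\<lambda>j. \<Sum>i<dim_row A. A $$ (i, j))"

definition zero_one_class :: "nat vec \<Rightarrow> nat vec \<Rightarrow> nat mat set" where
  "zero_one_class R S =
     {A \<in> carrier_mat (dim_vec R) (dim_vec S).
        elements_mat A \<subseteq> {0, 1} \<and> row_sum_vec A = R \<and> col_sum_vec A = S}"

definition nonincreasing_vec :: "nat vec \<Rightarrow> bool" where
  "nonincreasing_vec v \<longleftrightarrow> (\<forall>i j. i \<le> j \<longrightarrow> j < dim_vec v \<longrightarrow> v $ j \<le> v $ i)"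

text \<open>Vectors are indexed from 0, so the first \<open>f\<close> entries of \<open>S\<close> have indices \<open>{..<f}\<close>
  and the entries of \<open>R\<close> after the first \<open>e\<close> have indices \<open>{e..<dim_vec R}\<close>.
  The values are integers because the difference must not be truncated.\<close>

definition struct_entry :: "nat vec \<Rightarrow> nat vec \<Rightarrow> nat \<Rightarrow> nat \<Rightarrow> int" where
  "struct_entry R S e f =
     int e * int f - (\<Sum>j<f. int (S $ j)) + (\<Sum>i=e..<dim_vec R. int (R $ i))"

text \<open>A choice of 1s of \<open>A\<close> is given by the set of their positions.\<close>

definition term_selections :: "nat \<Rightarrow> nat mat \<Rightarrow> (nat \<times> nat) set set" where
  "term_selections t A =
     {P. P \<subseteq> {(i, j). i < dim_row A \<and> j < dim_col A \<and> A $$ (i, j) = 1} \<and>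
         (\<forall>j<dim_col A. card {i. (i, j) \<in> P} \<le> 1) \<and>
         (\<forall>i<dim_row A. card {j. (i, j) \<in> P} \<le> t)}"

definition term_rank :: "nat \<Rightarrow> nat mat \<Rightarrow> nat" where
  "term_rank t A = Max (card ` term_selections t A)"

definition max_term_rank :: "nat \<Rightarrow> nat vec \<Rightarrow> nat vec \<Rightarrow> nat" where
  "max_term_rank t R S = Max (term_rank t ` zero_one_class R S)"

text \<open>The sets under \<open>Max\<close> are finite, and nonempty when the class is, so both maxima are
  attained.\<close>

lemma term_selections_subset:
  "P \<in> term_selections t A \<Longrightarrow> P \<subseteq> {..<dim_row A} \<times> {..<dim_col A}"
  unfolding term_selections_def by (drule CollectD, drule conjunct1, erule subset_trans) auto

lemma finite_term_selections: "finite (term_selections t A)"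
proof (rule finite_subset)
  show "term_selections t A \<subseteq> Pow ({..<dim_row A} \<times> {..<dim_col A})"
    by (rule subsetI, rule PowI, rule term_selections_subset)
qed simp

lemma empty_in_term_selections: "{} \<in> term_selections t A"
  by (simp add: term_selections_def)

lemma term_rank_le: "term_rank t A \<le> dim_row A * dim_col A"
  unfolding term_rank_def
proof (rule Max.boundedI)
  show "finite (card ` term_selections t A)"
    by (rule finite_imageI[OF finite_term_selections])
  show "card ` term_selections t A \<noteq> {}"
    using empty_in_term_selections[of t A] by (simp add: ex_in_conv[symmetric] exI)
next
  fix k assume "k \<in> card ` term_selections t A"
  then obtain P where "k = card P" "P \<in> term_selections t A" by (rule imageE)
  then show "k \<le> dim_row A * dim_col A"
    using card_mono[OF _ term_selections_subset[of P t A]] by (simp add: card_cartesian_product)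
qed

lemma finite_term_rank_image: "finite (term_rank t ` zero_one_class R S)"
proof (rule finite_subset)
  show "term_rank t ` zero_one_class R S \<subseteq> {..dim_vec R * dim_vec S}"
  proof (rule image_subsetI)
    fix A assume "A \<in> zero_one_class R S"
    then have "A \<in> carrier_mat (dim_vec R) (dim_vec S)"
      unfolding zero_one_class_def by blast
    then show "term_rank t A \<in> {..dim_vec R * dim_vec S}"
      using term_rank_le[of t A] by (simp add: carrier_matD)
  qed
qed simp

end

theory Submission
  imports Defs
begin

text \<open>Removing \<open>k\<close> selected 1s from a matrix in the class leaves a \<open>(0,1)\<close>-matrix whose row sums
  lie between \<open>r\<^sub>i - t\<close> and \<open>r\<^sub>i\<close> and whose column sums lie between \<open>s\<^sub>j - 1\<close> and \<open>s\<^sub>j\<close>. The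
  least number of 1s of a matrix with such margins is a minimum flow; by max-flow min-cut, and
  because \<open>R\<close> and \<open>S\<close> are nonincreasing, it is at most the sum of \<open>R\<close> minus the claimed value.
  This minimizer \<open>C\<close> need not lie below any given \<open>A\<close> in the class, but a Kundu-type theorem
  repairs this: as the column sums of \<open>A - C\<close> are 0 or 1, interchanges inside \<open>A\<close> and
  inside \<open>C\<close> reduce the number of positions where \<open>C\<close> has a 1 and \<open>A\<close> has a 0, down to none.
  The positions of the 1s of \<open>A - C\<close> are then the required selection.\<close>

section \<open>Integer arrays and their margins\<close>

text \<open>Arrays are integer-valued functions, so that differences such as \<open>A - C\<close>
  and signed interchanges are formed without truncation. Values outside the \<open>m\<close> by
  \<open>n\<close> range are unconstrained.\<close>

definition binary :: "nat \<Rightarrow> nat \<Rightarrow> (nat \<Rightarrow> nat \<Rightarrow> int) \<Rightarrow> bool" where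
  "binary m n C \<longleftrightarrow> (\<forall>i<m. \<forall>j<n. C i j = 0 \<or> C i j = 1)"

definition row_sum :: "nat \<Rightarrow> (nat \<Rightarrow> nat \<Rightarrow> int) \<Rightarrow> nat \<Rightarrow> int" where
  "row_sum n C i = (\<Sum>j<n. C i j)"

definition col_sum :: "nat \<Rightarrow> (nat \<Rightarrow> nat \<Rightarrow> int) \<Rightarrow> nat \<Rightarrow> int" where
  "col_sum m C j = (\<Sum>i<m. C i j)"

definition entry_sum :: "nat \<Rightarrow> nat \<Rightarrow> (nat \<Rightarrow> nat \<Rightarrow> int) \<Rightarrow> int" where
  "entry_sum m n C = (\<Sum>i<m. row_sum n C i)"

lemma binaryD: "binary m n C \<Longrightarrow> i < m \<Longrightarrow> j < n \<Longrightarrow> C i j = 0 \<or> C i j = 1"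
  by (simp add: binary_def)

text \<open>The rows in \<open>I\<close> and the columns in \<open>J\<close> together count the
  block \<open>I\<close> by \<open>J\<close> twice and miss only the complementary block. Bounding
  the two blocks gives weak duality; if the first is all 1s, the second all 0s and the chosen
  margins meet their lower bounds, the total is a cut value.\<close>

lemma entry_sum_split:
  assumes I: "I \<subseteq> {..<m}" and J: "J \<subseteq> {..<n}"
  shows "entry_sum m n C = (\<Sum>i\<in>I. row_sum n C i) + (\<Sum>j\<in>J. col_sum m C j)
    - (\<Sum>i\<in>I. \<Sum>j\<in>J. C i j) + (\<Sum>i\<in>{..<m}-I. \<Sum>j\<in>{..<n}-J. C i j)"
proof -
  have 1: "entry_sum m n C = (\<Sum>i\<in>I. row_sum n C i) + (\<Sum>i\<in>{..<m}-I. row_sum n C i)"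
    unfolding entry_sum_def using sum.subset_diff[OF I] by (simp add: add.commute)
  have row: "row_sum n C i = (\<Sum>j\<in>J. C i j) + (\<Sum>j\<in>{..<n}-J. C i j)" for i
    unfolding row_sum_def using sum.subset_diff[OF J] by (simp add: add.commute)
  have "(\<Sum>j\<in>J. col_sum m C j) = (\<Sum>i<m. \<Sum>j\<in>J. C i j)"
    unfolding col_sum_def by (rule sum.swap)
  also have "\<dots> = (\<Sum>i\<in>I. \<Sum>j\<in>J. C i j) + (\<Sum>i\<in>{..<m}-I. \<Sum>j\<in>J. C i j)"
    using sum.subset_diff[OF I] by (simp add: add.commute)
  finally show ?thesis using 1 by (simp add: row sum.distrib)
qed

lemma sum_of_bool_eq: "(\<Sum>y<n. of_bool (y = j)) = (of_bool (j < n) :: int)" for j n :: nat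
  by (simp add: of_bool_def)

lemma sum_of_bool_mult:
  fixes g :: "nat \<Rightarrow> int"
  shows "(\<Sum>y<n. of_bool (y = j) * g y) = of_bool (j < n) * g j"
  by (simp add: of_bool_def if_distrib[of "\<lambda>u. u * _"] cong: if_cong)

section \<open>Minimum flows\<close>

text \<open>\<open>alt_walk m n E C k i\<close>: from row \<open>i\<close> one can walk along 1s of \<open>C\<close> to columns and back
  along 0s to rows, reaching a column in \<open>E\<close> after returning to a row \<open>k\<close> times.\<close>

fun alt_walk :: "nat \<Rightarrow> nat \<Rightarrow> nat set \<Rightarrow> (nat \<Rightarrow> nat \<Rightarrow> int) \<Rightarrow> nat \<Rightarrow> nat \<Rightarrow> bool" where
  "alt_walk m n E C 0 i = (\<exists>j<n. C i j = 1 \<and> j \<in> E)"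
| "alt_walk m n E C (Suc k) i =
    (\<exists>j<n. \<exists>x<m. C i j = 1 \<and> C x j = 0 \<and> alt_walk m n E C k x)"

text \<open>Delete the 1s and fill the 0s along the walk: every intermediate row and column loses as
  much as it gains. A shortest walk keeps the array binary, hence the strong induction on the
  length.\<close>

lemma alt_walk_augment:
  assumes "binary m n C" "i < m" "alt_walk m n E C k i"
  shows "\<exists>C' j. j \<in> E \<and> j < n \<and> binary m n C' \<and>
    (\<forall>x<m. row_sum n C' x = row_sum n C x - of_bool (x = i)) \<and>
    (\<forall>y<n. col_sum m C' y = col_sum m C y - of_bool (y = j))"
  using assms
proof (induction k arbitrary: C i rule: less_induct)
  case (less k)
  note bin = less.prems(1) and im = less.prems(2)
  show ?case
  \<comment> \<open>A shorter walk from \<open>i\<close> is settled by induction; otherwise the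
    given walk is shortest.\<close>
  proof (cases "\<exists>l<k. alt_walk m n E C l i")
    case True
    then show ?thesis using less.IH bin im by blast
  next
    case False
    then have short: "\<And>l. l < k \<Longrightarrow> \<not> alt_walk m n E C l i" by blast
    show ?thesis
    proof (cases k)
      case 0
      then obtain j where j: "j < n" "C i j = 1" "j \<in> E" using less.prems(3) by auto
      define C' where "C' = (\<lambda>x y. C x y - of_bool (x = i) * of_bool (y = j))"
      have "binary m n C'"
        using bin j unfolding binary_def C'_def by (auto simp: of_bool_def)
      moreover have "row_sum n C' x = row_sum n C x - of_bool (x = i)" for x
        using j by (simp add: row_sum_def C'_def sum_subtractf sum_of_bool_eq
            flip: sum_distrib_left)
      moreover have "col_sum m C' y = col_sum m C y - of_bool (y = j)" for y
        using im by (simp add: col_sum_def C'_def sum_subtractf sum_of_bool_eq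
            flip: sum_distrib_right)
      ultimately show ?thesis using j by blast
    next
      case (Suc l)
      then obtain j z where j: "j < n" "C i j = 1" and z: "z < m" "C z j = 0"
        and walk: "alt_walk m n E C l z"
        using less.prems(3) by auto
      have zi: "z \<noteq> i" using j z by auto
      \<comment> \<open>The first step moves the 1 at \<open>(i, j)\<close> to
        \<open>(z, j)\<close>. The surplus this creates in row \<open>z\<close> is removed by the
        rest of the walk, which starts there.\<close>
      define D where "D = (\<lambda>x y. C x y + (of_bool (x = z) - of_bool (x = i)) * of_bool (y = j))"
      have binD: "binary m n D"
        using bin j z zi unfolding binary_def D_def by (auto simp: of_bool_def)
      have rowD: "row_sum n D x = row_sum n C x + of_bool (x = z) - of_bool (x = i)" for x
        using j by (simp add: row_sum_def D_def sum.distrib sum_of_bool_eq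
            flip: sum_distrib_left)
      have colD: "col_sum m D y = col_sum m C y" for y
        using im z by (simp add: col_sum_def D_def sum.distrib sum_subtractf sum_of_bool_eq
            flip: sum_distrib_right)
      \<comment> \<open>The rest of a shortest walk survives the modification: were it to use a changed entry,
        it could be shortcut to a shorter walk from \<open>i\<close>.\<close>
      have keep: "alt_walk m n E D q x" if "q \<le> l" "x \<noteq> i" "alt_walk m n E C q x" for q x
        using that
      proof (induction q arbitrary: x)
        case 0
        then obtain y where y: "y < n" "C x y = 1" "y \<in> E" by auto
        have "D x y = 1" using y 0 z by (auto simp: D_def of_bool_def)
        then show ?case using y by auto
      next
        case (Suc q)
        then obtain y w where y: "y < n" "w < m" "C x y = 1" "C w y = 0"
          and w: "alt_walk m n E C q w" by auto
        have "w \<noteq> i" using short[of q] w Suc.prems(1) \<open>k = Suc l\<close> by auto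
        have "\<not> (w = z \<and> y = j)"
        proof
          assume "w = z \<and> y = j"
          then have "alt_walk m n E C (Suc q) i" using j z w by auto
          then show False using short[of "Suc q"] Suc.prems(1) \<open>k = Suc l\<close> by auto
        qed
        then have "D w y = 0" using y \<open>w \<noteq> i\<close> by (auto simp: D_def of_bool_def)
        moreover have "D x y = 1" using y Suc.prems z by (auto simp: D_def of_bool_def)
        moreover have "alt_walk m n E D q w"
          using Suc.IH[OF _ \<open>w \<noteq> i\<close> w] Suc.prems(1) by simp
        ultimately show ?case using y by auto
      qed
      have "alt_walk m n E D l z" using keep[OF _ zi walk] by simp
      then obtain C' j' where "j' \<in> E" "j' < n" "binary m n C'"
        "\<forall>x<m. row_sum n C' x = row_sum n D x - of_bool (x = z)"
        "\<forall>y<n. col_sum m C' y = col_sum m D y - of_bool (y = j')"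
        using less.IH[OF _ binD z(1)] Suc by blast
      then show ?thesis
        by (intro exI[of _ C'] exI[of _ j']) (simp add: rowD colD)
    qed
  qed
qed

text \<open>A feasible array with fewest 1s admits no augmentation from a row above its lower bound
  to a column above its lower bound, and reachability from such rows yields the cut. Augmenting only
  lowers sums, so upper bounds persist and the cut involves only \<open>a\<close> and
  \<open>c\<close>.\<close>

lemma min_flow_max_cut:
  fixes a r c s :: "nat \<Rightarrow> int"
  assumes "binary m n C0"
    and "\<And>i. i < m \<Longrightarrow> a i \<le> row_sum n C0 i \<and> row_sum n C0 i \<le> r i"
    and "\<And>j. j < n \<Longrightarrow> c j \<le> col_sum m C0 j \<and> col_sum m C0 j \<le> s j"
  shows "\<exists>C I J. binary m n C \<and> (\<forall>i<m. a i \<le> row_sum n C i \<and> row_sum n C i \<le> r i) \<and>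
    (\<forall>j<n. c j \<le> col_sum m C j \<and> col_sum m C j \<le> s j) \<and>
    I \<subseteq> {..<m} \<and> J \<subseteq> {..<n} \<and>
    entry_sum m n C = sum a I + sum c J - int (card I) * int (card J)"
proof -
  define ok where "ok C \<longleftrightarrow> binary m n C \<and>
    (\<forall>i<m. a i \<le> row_sum n C i \<and> row_sum n C i \<le> r i) \<and>
    (\<forall>j<n. c j \<le> col_sum m C j \<and> col_sum m C j \<le> s j)" for C
  have "ok C0" using assms by (simp add: ok_def)
  \<comment> \<open>Truncation by \<open>nat\<close> is harmless: totals of binary arrays are
    nonnegative.\<close>
  then obtain C where C: "ok C" and min: "\<And>D. ok D \<Longrightarrow> nat (entry_sum m n C) \<le> nat (entry_sum m n D)"
    using ex_has_least_nat[of ok C0 "\<lambda>D. nat (entry_sum m n D)"] by blast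
  have bin: "binary m n C" using C by (simp add: ok_def)
  have nonneg: "0 \<le> row_sum n D x" if "binary m n D" "x < m" for D x
    unfolding row_sum_def using that by (intro sum_nonneg) (force dest: binaryD)
  define E where "E = {j. j < n \<and> c j < col_sum m C j}"
  \<comment> \<open>The rows reachable from a row with slack, each move going from a 1 to a 0 of the
    same column.\<close>
  define X where "X = {x. x < m \<and> (\<exists>i<m. a i < row_sum n C i \<and>
    (i, x) \<in> {(u, v). u < m \<and> v < m \<and> (\<exists>j<n. C u j = 1 \<and> C v j = 0)}\<^sup>*)}"
  have no_walk: "\<not> alt_walk m n E C k i" if "i < m" "a i < row_sum n C i" for i k
  proof
    assume "alt_walk m n E C k i"
    from alt_walk_augment[OF bin \<open>i < m\<close> this] obtain D j where j: "j \<in> E" "j < n"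
      and D: "binary m n D" "\<forall>x<m. row_sum n D x = row_sum n C x - of_bool (x = i)"
        "\<forall>y<n. col_sum m D y = col_sum m C y - of_bool (y = j)"
      by blast
    \<comment> \<open>Row \<open>i\<close> and column \<open>j\<close> both had slack, so
      \<open>D\<close> is feasible; its total is smaller by one, against minimality.\<close>
    have "ok D"
      using C D j that unfolding ok_def E_def by (auto simp: of_bool_def)
    then have "nat (entry_sum m n C) \<le> nat (entry_sum m n D)" by (rule min)
    moreover have "entry_sum m n D = entry_sum m n C - 1"
      using D \<open>i < m\<close> by (simp add: entry_sum_def sum_subtractf sum_of_bool_eq)
    moreover have "0 \<le> entry_sum m n D"
      unfolding entry_sum_def by (intro sum_nonneg nonneg) (use D in auto)
    ultimately show False by simp
  qed
  have walkX: "\<not> alt_walk m n E C k x" if "x \<in> X" for x k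
  proof -
    from that obtain i where i: "i < m" "a i < row_sum n C i"
      and path: "(i, x) \<in> {(u, v). u < m \<and> v < m \<and> (\<exists>j<n. C u j = 1 \<and> C v j = 0)}\<^sup>*"
      unfolding X_def by blast
    \<comment> \<open>A walk from the end of an edge extends to a walk from its start that is longer
      by one, so all lengths are excluded at once.\<close>
    have "\<not> (\<exists>k. alt_walk m n E C k x)"
      using path
    proof (induction rule: rtrancl_induct)
      case base
      then show ?case using no_walk i by blast
    next
      case (step u v)
      then obtain j where "v < m" "j < n" "C u j = 1" "C v j = 0" by blast
      then have "alt_walk m n E C (Suc k) u" if "alt_walk m n E C k v" for k
        using that by auto
      then show ?case using step.IH by blast
    qed
    then show ?thesis by blast
  qed
  have closed: "v \<in> X" if "u \<in> X" "v < m" "j < n" "C u j = 1" "C v j = 0" for u v j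
    using that unfolding X_def
    by (auto intro!: rtrancl_into_rtrancl)
  \<comment> \<open>Rows in \<open>I\<close> have no slack, and columns in \<open>J\<close> lie
    outside \<open>E\<close> because a reachable row has a 1 there. A 0 in \<open>I\<close> by
    \<open>J\<close> would make its row reachable; a 1 in the complementary block would put its
    column into \<open>J\<close>.\<close>
  define I where "I = {..<m} - X"
  define J where "J = {j. j < n \<and> (\<exists>x\<in>X. C x j = 1)}"
  have XI: "{..<m} - I = X" unfolding I_def X_def by auto
  have IJ: "I \<subseteq> {..<m}" "J \<subseteq> {..<n}" unfolding I_def J_def by auto
  have rowI: "row_sum n C i = a i" if "i \<in> I" for i
    using that C unfolding I_def X_def ok_def by force
  have colJ: "col_sum m C j = c j" if "j \<in> J" for j
  proof -
    from that obtain x where x: "j < n" "x \<in> X" "C x j = 1" unfolding J_def by blast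
    then have "j \<notin> E" using walkX[of x 0] by auto
    then show ?thesis using x C unfolding E_def ok_def by force
  qed
  have one: "C i j = 1" if "i \<in> I" "j \<in> J" for i j
  proof -
    from that obtain x where x: "j < n" "x \<in> X" "C x j = 1" unfolding J_def by blast
    have "i < m" "i \<notin> X" using that unfolding I_def by auto
    then show ?thesis using closed[of x i j] x binaryD[OF bin] by blast
  qed
  have zero: "C i j = 0" if "i \<in> X" "j \<in> {..<n} - J" for i j
    using that binaryD[OF bin, of i j] unfolding J_def X_def by auto
  have "entry_sum m n C = sum a I + sum c J - int (card I) * int (card J)"
    using entry_sum_split[OF IJ, of C] by (simp add: XI rowI colJ one zero)
  then show ?thesis using C IJ unfolding ok_def by blast
qed

section \<open>Nesting two classes by interchanges\<close>

text \<open>The sign pattern of a 2 by 2 interchange: +1 at \<open>(i, j)\<close> and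
  \<open>(k, l)\<close>, -1 at \<open>(i, l)\<close> and \<open>(k, j)\<close>. The product form
  makes all row and column sums vanish.\<close>

definition interchange :: "nat \<Rightarrow> nat \<Rightarrow> nat \<Rightarrow> nat \<Rightarrow> nat \<Rightarrow> nat \<Rightarrow> int" where
  "interchange i k j l x y =
    (of_bool (x = i) - of_bool (x = k)) * (of_bool (y = j) - of_bool (y = l))"

text \<open>Measures how an interchange changes the number of bad positions, with weight
  \<open>C\<close> when \<open>A\<close> is modified and \<open>1 - A\<close> when \<open>C\<close>
  is.\<close>

lemma interchange_weighted_sum:
  fixes w :: "nat \<Rightarrow> nat \<Rightarrow> int"
  assumes "i < m" "k < m" "j < n" "l < n"
  shows "(\<Sum>x<m. \<Sum>y<n. interchange i k j l x y * w x y) = w i j - w i l - w k j + w k l"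
proof -
  have "(\<Sum>y<n. interchange i k j l x y * w x y) =
      (of_bool (x = i) - of_bool (x = k)) * (w x j - w x l)" for x
    using assms by (simp add: interchange_def left_diff_distrib mult.assoc sum_subtractf
        sum_of_bool_mult flip: sum_distrib_left)
  then show ?thesis
    using assms by (simp add: left_diff_distrib sum_subtractf sum_of_bool_mult)
qed

lemma interchange_margins:
  assumes "i < m" "k < m" "j < n" "l < n"
  shows "row_sum n (\<lambda>x y. A x y + c * interchange i k j l x y) x = row_sum n A x"
    and "col_sum m (\<lambda>x y. A x y + c * interchange i k j l x y) y = col_sum m A y"
  using assms
  by (simp_all add: row_sum_def col_sum_def interchange_def sum.distrib sum_subtractf
      sum_of_bool_eq flip: sum_distrib_left sum_distrib_right)

text \<open>Induction on the number \<open>N\<close> of bad positions, where \<open>C\<close> has a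
  1 and \<open>A\<close> a 0. Row \<open>i\<close> of a bad position \<open>(i, j)\<close> also has
  a column \<open>l\<close> with the opposite pattern; either some row \<open>k\<close> allows an
  interchange on columns \<open>j\<close> and \<open>l\<close> that lowers \<open>N\<close>, or the
  column sums contradict the gap of at most 1.\<close>

lemma nested_pair:
  assumes "binary m n A" "binary m n C"
    and "\<And>i. i < m \<Longrightarrow> row_sum n C i \<le> row_sum n A i"
    and "\<And>j. j < n \<Longrightarrow> col_sum m C j \<le> col_sum m A j \<and> col_sum m A j \<le> col_sum m C j + 1"
  shows "\<exists>A' C'. binary m n A' \<and> binary m n C' \<and> (\<forall>i<m. \<forall>j<n. C' i j \<le> A' i j) \<and>
    (\<forall>i<m. row_sum n A' i = row_sum n A i \<and> row_sum n C' i = row_sum n C i) \<and>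
    (\<forall>j<n. col_sum m A' j = col_sum m A j \<and> col_sum m C' j = col_sum m C j)"
  using assms
proof (induction "nat (\<Sum>i<m. \<Sum>j<n. C i j * (1 - A i j))" arbitrary: A C rule: less_induct)
  case less
  note binA = less.prems(1) and binC = less.prems(2)
  let ?N = "\<lambda>A C. (\<Sum>i<m. \<Sum>j<n. C i j * (1 - A i j)) :: int"
  have N_nonneg: "0 \<le> ?N A' C'" if "binary m n A'" "binary m n C'" for A' C'
    by (intro sum_nonneg) (use that in \<open>force dest: binaryD\<close>)
  show ?case
  proof (cases "\<forall>i<m. \<forall>j<n. C i j \<le> A i j")
    case True
    then show ?thesis using binA binC by blast
  next
    case False
    then obtain i j where i: "i < m" and j: "j < n" and blue: "\<not> C i j \<le> A i j" by blast
    have ij: "C i j = 1" "A i j = 0"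
      using blue binaryD[OF binA i j] binaryD[OF binC i j] by auto
    \<comment> \<open>The row sum of \<open>C\<close> does not exceed that of \<open>A\<close>, so
      the excess at \<open>j\<close> is made up elsewhere in row \<open>i\<close>.\<close>
    have "\<exists>l<n. C i l < A i l"
    proof (rule ccontr)
      assume "\<not> ?thesis"
      then have "\<forall>y<n. A i y \<le> C i y" by (meson not_less)
      moreover have "A i j < C i j" using ij by simp
      ultimately have "row_sum n A i < row_sum n C i"
        unfolding row_sum_def using j by (intro sum_strict_mono_ex1) auto
      then show False using less.prems(3)[OF i] by simp
    qed
    then obtain l where l: "l < n" and "C i l < A i l" by blast
    then have il: "C i l = 0" "A i l = 1"
      using binaryD[OF binA i l] binaryD[OF binC i l] by auto
    show ?thesis
    \<comment> \<open>An interchange inside \<open>A\<close> lowers \<open>N\<close> by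
      \<open>1 - C k j + C k l\<close>, which is positive unless \<open>C\<close> has the excluded
      pattern in row \<open>k\<close>.\<close>
    proof (cases "\<exists>k<m. A k j = 1 \<and> A k l = 0 \<and> \<not> (C k j = 1 \<and> C k l = 0)")
      case True
      then obtain k where k: "k < m" "A k j = 1" "A k l = 0" "\<not> (C k j = 1 \<and> C k l = 0)"
        by blast
      define A' where "A' = (\<lambda>x y. A x y + 1 * interchange i k j l x y)"
      note marg = interchange_margins[OF i k(1) j l, of A 1, folded A'_def]
      have "k \<noteq> i" "j \<noteq> l" using k ij il by auto
      then have bin: "binary m n A'"
        using binA k ij il by (auto simp: binary_def A'_def interchange_def of_bool_def)
      have "?N A' C = ?N A C - (\<Sum>x<m. \<Sum>y<n. interchange i k j l x y * C x y)"
        by (simp add: A'_def algebra_simps sum.distrib sum_subtractf)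
      also have "\<dots> = ?N A C - (1 - C k j + C k l)"
        by (simp add: interchange_weighted_sum[OF i k(1) j l] ij il)
      finally have "nat (?N A' C) < nat (?N A C)"
        using N_nonneg[OF bin binC] k(4) binaryD[OF binC k(1) j] binaryD[OF binC k(1) l] by auto
      from less.hyps[OF this bin binC] show ?thesis
        using less.prems(3,4) by (simp add: marg)
    next
      case noA: False
      show ?thesis
      \<comment> \<open>Dually, an interchange inside \<open>C\<close> lowers \<open>N\<close> by
        \<open>1 + A k j - A k l\<close>, which vanishes only for the excluded pattern of
        \<open>A\<close>.\<close>
      proof (cases "\<exists>k<m. C k j = 0 \<and> C k l = 1 \<and> \<not> (A k j = 0 \<and> A k l = 1)")
        case True
        then obtain k where k: "k < m" "C k j = 0" "C k l = 1" "\<not> (A k j = 0 \<and> A k l = 1)"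
          by blast
        define C' where "C' = (\<lambda>x y. C x y + (-1) * interchange i k j l x y)"
        note marg = interchange_margins[OF i k(1) j l, of C "-1", folded C'_def]
        have "k \<noteq> i" "j \<noteq> l" using k ij il by auto
        then have bin: "binary m n C'"
          using binC k ij il by (auto simp: binary_def C'_def interchange_def of_bool_def)
        have "?N A C' = ?N A C - (\<Sum>x<m. \<Sum>y<n. interchange i k j l x y * (1 - A x y))"
          by (simp add: C'_def algebra_simps sum.distrib sum_subtractf)
        also have "\<dots> = ?N A C - (1 + A k j - A k l)"
          by (simp add: interchange_weighted_sum[OF i k(1) j l] ij il)
        finally have "nat (?N A C') < nat (?N A C)"
          using N_nonneg[OF binA bin] k(4) binaryD[OF binA k(1) j] binaryD[OF binA k(1) l] by auto
        from less.hyps[OF this binA bin] show ?thesis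
          using less.prems(3,4) by (simp add: marg)
      next
        case noC: False
        \<comment> \<open>Without an improving interchange, column \<open>l\<close> of \<open>A - C\<close> exceeds column \<open>j\<close> by
          at least 2, although both column sums are 0 or 1.\<close>
        have "A k j - C k j + 2 * of_bool (k = i) \<le> A k l - C k l" if "k < m" for k
        proof (cases "k = i")
          case True
          then show ?thesis using ij il by simp
        next
          case False
          \<comment> \<open>The goal amounts to \<open>A k j - A k l \<le> C k j - C k l\<close>: if
            the left side is 1 then so is the right, and if the right side is -1 then so is the
            left.\<close>
          have "A k j = 1 \<and> A k l = 0 \<longrightarrow> C k j = 1 \<and> C k l = 0"
            "C k j = 0 \<and> C k l = 1 \<longrightarrow> A k j = 0 \<and> A k l = 1"
            using noA noC that by blast+
          then show ?thesis
            using False binaryD[OF binA that j] binaryD[OF binA that l]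
              binaryD[OF binC that j] binaryD[OF binC that l] by (elim disjE) simp_all
        qed
        then have "(\<Sum>k<m. A k j - C k j + 2 * of_bool (k = i)) \<le> (\<Sum>k<m. A k l - C k l)"
          by (intro sum_mono) simp
        then have "col_sum m A j - col_sum m C j + 2 \<le> col_sum m A l - col_sum m C l"
          using i by (simp add: col_sum_def sum.distrib sum_subtractf sum_of_bool_eq
              flip: sum_distrib_left)
        then show ?thesis using less.prems(4)[OF j] less.prems(4)[OF l] by simp
      qed
    qed
  qed
qed

section \<open>The term rank formula\<close>

text \<open>The largest index in a set of size \<open>e + 1\<close> is at least \<open>e\<close>, so
  its term is at most \<open>r e\<close>; remove it and induct.\<close>

lemma sum_le_initial_sum:
  fixes r :: "nat \<Rightarrow> int"
  assumes mono: "\<And>i k. i \<le> k \<Longrightarrow> k < m \<Longrightarrow> r k \<le> r i" and I: "I \<subseteq> {..<m}"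
  shows "sum r I \<le> sum r {..<card I}"
  using I
proof (induction "card I" arbitrary: I)
  case 0
  then show ?case using finite_subset by fastforce
next
  case (Suc e)
  have fin: "finite I" using Suc.prems finite_subset by blast
  define k where "k = Max I"
  have "I \<noteq> {}" using Suc.hyps(2) by auto
  then have k: "k \<in> I" using fin by (simp add: k_def)
  have "I \<subseteq> {..k}" using fin by (auto simp: k_def)
  then have "card I \<le> Suc k" using card_mono[of "{..k}" I] by simp
  then have "r k \<le> r e" using mono[of e k] k Suc by auto
  moreover have "sum r (I - {k}) \<le> sum r {..<e}"
  proof -
    have "e = card (I - {k})"
      using Suc.hyps(2) k fin by (metis card_Diff_singleton diff_Suc_1)
    with Suc.hyps(1)[OF this] Suc.prems show ?thesis by auto
  qed
  ultimately show ?case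
    using sum.remove[OF fin k, of r] Suc.hyps(2)[symmetric] by simp
qed

text \<open>Discarding the indices with negative entries leaves the truncated sums unchanged and can
  only shrink the subtracted product. Monotonicity then replaces the remaining sets by initial
  segments of the same sizes. In the application \<open>r\<close> and \<open>s\<close> are the
  margins lowered by \<open>t\<close> and by 1.\<close>

lemma truncated_cut_le_initial_cut:
  fixes r s :: "nat \<Rightarrow> int"
  assumes r: "\<And>i k. i \<le> k \<Longrightarrow> k < m \<Longrightarrow> r k \<le> r i"
    and s: "\<And>i k. i \<le> k \<Longrightarrow> k < n \<Longrightarrow> s k \<le> s i"
    and I: "I \<subseteq> {..<m}" and J: "J \<subseteq> {..<n}"
  shows "\<exists>e\<le>m. \<exists>f\<le>n. (\<Sum>i\<in>I. max 0 (r i)) + (\<Sum>j\<in>J. max 0 (s j)) - int (card I) * int (card J)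
    \<le> sum r {..<e} + sum s {..<f} - int e * int f"
proof -
  have fin: "finite I" "finite J" using I J finite_subset by blast+
  let ?I = "{i\<in>I. 0 \<le> r i}" and ?J = "{j\<in>J. 0 \<le> s j}"
  have "(\<Sum>i\<in>I. max 0 (r i)) = sum r ?I"
    using fin by (simp add: sum.inter_filter max_def)
  also have "\<dots> \<le> sum r {..<card ?I}"
    by (rule sum_le_initial_sum[OF r]) (use I in auto)
  finally have 1: "(\<Sum>i\<in>I. max 0 (r i)) \<le> sum r {..<card ?I}" .
  have "(\<Sum>j\<in>J. max 0 (s j)) = sum s ?J"
    using fin by (simp add: sum.inter_filter max_def)
  also have "\<dots> \<le> sum s {..<card ?J}"
    by (rule sum_le_initial_sum[OF s]) (use J in auto)
  finally have 2: "(\<Sum>j\<in>J. max 0 (s j)) \<le> sum s {..<card ?J}" .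
  have le: "card ?I \<le> card I" "card ?J \<le> card J" using fin by (auto intro: card_mono)
  then have "int (card ?I) * int (card ?J) \<le> int (card I) * int (card J)"
    by (intro mult_mono) auto
  moreover have "card I \<le> m" "card J \<le> n"
    using card_mono[OF _ I] card_mono[OF _ J] by auto
  ultimately show ?thesis using 1 2 le
    by (intro exI[of _ "card ?I"] exI[of _ "card ?J"] conjI) auto
qed

section \<open>Translation of selections, matrices and structure entries into arrays and
  cuts\<close>

lemma card_fibres_eq_margins:
  assumes P: "P \<subseteq> {..<m} \<times> {..<n}"
  defines "B \<equiv> \<lambda>i j. of_bool ((i, j) \<in> P)"
  shows "row_sum n B i = int (card {j. (i, j) \<in> P})"
    and "col_sum m B j = int (card {i. (i, j) \<in> P})"
    and "entry_sum m n B = int (card P)"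
proof -
  have 1: "{j. (i, j) \<in> P} = {j\<in>{..<n}. (i, j) \<in> P}" for i using P by auto
  have 2: "{i. (i, j) \<in> P} = {i\<in>{..<m}. (i, j) \<in> P}" for j using P by auto
  have row: "row_sum n B i = int (card {j. (i, j) \<in> P})" for i
    by (simp add: row_sum_def B_def 1 of_bool_def Int_def flip: sum.inter_filter)
  then show "row_sum n B i = int (card {j. (i, j) \<in> P})" .
  show "col_sum m B j = int (card {i. (i, j) \<in> P})"
    by (simp add: col_sum_def B_def 2 of_bool_def Int_def flip: sum.inter_filter)
  have "P = (SIGMA i:{..<m}. {j. (i, j) \<in> P})" using P by auto
  moreover have "card (SIGMA i:{..<m}. {j. (i, j) \<in> P}) = (\<Sum>i<m. card {j. (i, j) \<in> P})"
    by (rule card_SigmaI) (auto simp: 1)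
  ultimately show "entry_sum m n B = int (card P)"
    by (simp add: entry_sum_def row)
qed

lemma zero_one_class_iff:
  assumes "R \<in> carrier_vec m" "S \<in> carrier_vec n"
  shows "A \<in> zero_one_class R S \<longleftrightarrow> A \<in> carrier_mat m n \<and>
    binary m n (\<lambda>i j. int (A $$ (i, j))) \<and>
    (\<forall>i<m. row_sum n (\<lambda>i j. int (A $$ (i, j))) i = int (R $ i)) \<and>
    (\<forall>j<n. col_sum m (\<lambda>i j. int (A $$ (i, j))) j = int (S $ j))"
proof (cases "A \<in> carrier_mat m n")
  case True
  have "elements_mat A \<subseteq> {0, 1} \<longleftrightarrow> binary m n (\<lambda>i j. int (A $$ (i, j)))"
  proof -
    have "elements_mat A = (\<Union>i<m. \<Union>j<n. {A $$ (i, j)})"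
      using True by (force simp: elements_mat_def)
    then have "elements_mat A \<subseteq> {0, 1} \<longleftrightarrow> (\<forall>i<m. \<forall>j<n. A $$ (i, j) \<in> {0, 1})"
      by (simp only: UN_subset_iff Ball_def lessThan_iff insert_subset empty_subsetI simp_thms)
    then show ?thesis by (simp add: binary_def)
  qed
  moreover have "row_sum_vec A = R \<longleftrightarrow>
      (\<forall>i<m. row_sum n (\<lambda>i j. int (A $$ (i, j))) i = int (R $ i))"
    using True assms by (auto simp: vec_eq_iff row_sum_vec_def row_sum_def simp flip: of_nat_sum)
  moreover have "col_sum_vec A = S \<longleftrightarrow>
      (\<forall>j<n. col_sum m (\<lambda>i j. int (A $$ (i, j))) j = int (S $ j))"
    using True assms by (auto simp: vec_eq_iff col_sum_vec_def col_sum_def simp flip: of_nat_sum)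
  ultimately show ?thesis using True
    by (simp only: zero_one_class_def carrier_vecD[OF assms(1)] carrier_vecD[OF assms(2)]
        mem_Collect_eq)
next
  case False
  then show ?thesis using assms by (auto simp: zero_one_class_def)
qed

text \<open>The terms \<open>t * e\<close> and \<open>f\<close> lower each of the first
  \<open>e\<close> row sums by \<open>t\<close> and each of the first \<open>f\<close> column sums
  by 1. The claimed bound is thus the total of \<open>R\<close> minus the cut value of two initial
  segments.\<close>

lemma struct_entry_alt:
  assumes "R \<in> carrier_vec m" "e \<le> m"
  shows "struct_entry R S e f + int t * int e + int f =
    (\<Sum>i<m. int (R $ i)) - ((\<Sum>i<e. int (R $ i) - int t) + (\<Sum>j<f. int (S $ j) - 1) - int e * int f)"
proof -
  have "{..<m} = {..<e} \<union> {e..<m}" using assms by auto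
  then have "(\<Sum>i<m. int (R $ i)) = (\<Sum>i<e. int (R $ i)) + (\<Sum>i=e..<m. int (R $ i))"
    by (simp add: sum.union_disjoint ivl_disj_int)
  then show ?thesis using assms by (simp add: struct_entry_def sum_subtractf)
qed

section \<open>The two inequalities of the duality\<close>

text \<open>Weak duality: the array \<open>C\<close> of unselected 1s has row sums at least
  \<open>R - t\<close> and column sums at least \<open>S - 1\<close>, so its total is at least the
  cut value of any pair of initial segments.\<close>

lemma term_selection_card_le:
  assumes R: "R \<in> carrier_vec m" and S: "S \<in> carrier_vec n"
    and A: "A \<in> zero_one_class R S" and P: "P \<in> term_selections t A"
    and e: "e \<le> m" and f: "f \<le> n"
  shows "int (card P) \<le> struct_entry R S e f + int t * int e + int f"
proof -
  let ?a = "\<lambda>i j. int (A $$ (i, j))"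
  let ?b = "\<lambda>i j. of_bool ((i, j) \<in> P) :: int"
  define C where "C = (\<lambda>i j. ?a i j - ?b i j)"
  from A have dim: "dim_row A = m" "dim_col A = n" and bin: "binary m n ?a"
    and rows: "\<And>i. i < m \<Longrightarrow> row_sum n ?a i = int (R $ i)"
    and cols: "\<And>j. j < n \<Longrightarrow> col_sum m ?a j = int (S $ j)"
    by (auto simp: zero_one_class_iff[OF R S])
  have sub: "P \<subseteq> {..<m} \<times> {..<n}" using term_selections_subset[OF P] dim by simp
  note marg = card_fibres_eq_margins[OF sub]
  have C01: "0 \<le> C i j" "C i j \<le> 1" if "i < m" "j < n" for i j
    using binaryD[OF bin that] P that unfolding term_selections_def C_def
    by (auto simp: of_bool_def)
  have rowC: "int (R $ i) - int t \<le> row_sum n C i" if "i < m" for i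
  proof -
    have "card {j. (i, j) \<in> P} \<le> t" using P that dim by (auto simp: term_selections_def)
    moreover have "row_sum n C i = row_sum n ?a i - row_sum n ?b i"
      by (simp add: row_sum_def C_def sum_subtractf)
    ultimately show ?thesis using rows[OF that] marg(1)[of i] by simp
  qed
  have colC: "int (S $ j) - 1 \<le> col_sum m C j" if "j < n" for j
  proof -
    have "card {i. (i, j) \<in> P} \<le> 1" using P that dim by (auto simp: term_selections_def)
    moreover have "col_sum m C j = col_sum m ?a j - col_sum m ?b j"
      by (simp add: col_sum_def C_def sum_subtractf)
    ultimately show ?thesis using cols[OF that] marg(2)[of j] by simp
  qed
  have "entry_sum m n C = entry_sum m n ?a - entry_sum m n ?b"
    by (simp add: entry_sum_def row_sum_def C_def sum_subtractf)
  then have card: "int (card P) = (\<Sum>i<m. int (R $ i)) - entry_sum m n C"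
    using marg(3) rows by (simp add: entry_sum_def)
  \<comment> \<open>The four terms of \<open>entry_sum_split\<close> are bounded in turn; the
    \<open>e\<close> by \<open>f\<close> block holds at most \<open>e * f\<close> 1s.\<close>
  have "(\<Sum>i<e. int (R $ i) - int t) \<le> (\<Sum>i<e. row_sum n C i)"
    using e by (intro sum_mono rowC) auto
  moreover have "(\<Sum>j<f. int (S $ j) - 1) \<le> (\<Sum>j<f. col_sum m C j)"
    using f by (intro sum_mono colC) auto
  moreover have "(\<Sum>i<e. \<Sum>j<f. C i j) \<le> (\<Sum>i<e. \<Sum>j<f. 1)"
    using e f by (intro sum_mono C01) auto
  moreover have "0 \<le> (\<Sum>i\<in>{..<m}-{..<e}. \<Sum>j\<in>{..<n}-{..<f}. C i j)"
    by (intro sum_nonneg C01) auto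
  moreover have "{..<e} \<subseteq> {..<m}" "{..<f} \<subseteq> {..<n}" using e f by auto
  ultimately have "(\<Sum>i<e. int (R $ i) - int t) + (\<Sum>j<f. int (S $ j) - 1) - int e * int f
      \<le> entry_sum m n C"
    using entry_sum_split[of "{..<e}" m "{..<f}" n C] by simp
  then show ?thesis unfolding struct_entry_alt[OF R e] card by simp
qed

lemma term_selection_attaining:
  assumes R: "R \<in> carrier_vec m" and S: "S \<in> carrier_vec n"
    and "nonincreasing_vec R" "nonincreasing_vec S" and A: "A \<in> zero_one_class R S"
  shows "\<exists>A'\<in>zero_one_class R S. \<exists>P\<in>term_selections t A'. \<exists>e\<le>m. \<exists>f\<le>n.
    struct_entry R S e f + int t * int e + int f \<le> int (card P)"
proof -
  let ?a = "\<lambda>i j. int (A $$ (i, j))"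
  let ?r = "\<lambda>i. int (R $ i)" and ?s = "\<lambda>j. int (S $ j)"
  from A have bin: "binary m n ?a"
    and rows: "\<And>i. i < m \<Longrightarrow> row_sum n ?a i = ?r i"
    and cols: "\<And>j. j < n \<Longrightarrow> col_sum m ?a j = ?s j"
    by (auto simp: zero_one_class_iff[OF R S])
  have "\<exists>C I J. binary m n C \<and>
    (\<forall>i<m. max 0 (?r i - int t) \<le> row_sum n C i \<and> row_sum n C i \<le> ?r i) \<and>
    (\<forall>j<n. max 0 (?s j - 1) \<le> col_sum m C j \<and> col_sum m C j \<le> ?s j) \<and>
    I \<subseteq> {..<m} \<and> J \<subseteq> {..<n} \<and>
    entry_sum m n C = (\<Sum>i\<in>I. max 0 (?r i - int t)) + (\<Sum>j\<in>J. max 0 (?s j - 1))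
      - int (card I) * int (card J)"
    \<comment> \<open>The array of \<open>A\<close> itself is the initial feasible one: its margins
      equal the upper bounds.\<close>
    by (rule min_flow_max_cut[OF bin]) (simp_all add: rows cols)
  then obtain C I J where C: "binary m n C"
    and rowC: "\<And>i. i < m \<Longrightarrow> ?r i - int t \<le> row_sum n C i \<and> row_sum n C i \<le> ?r i"
    and colC: "\<And>j. j < n \<Longrightarrow> ?s j - 1 \<le> col_sum m C j \<and> col_sum m C j \<le> ?s j"
    and IJ: "I \<subseteq> {..<m}" "J \<subseteq> {..<n}"
    and tot: "entry_sum m n C = (\<Sum>i\<in>I. max 0 (?r i - int t)) + (\<Sum>j\<in>J. max 0 (?s j - 1))
      - int (card I) * int (card J)"
    by (metis (no_types, lifting) max.bounded_iff)
  have "\<exists>e\<le>m. \<exists>f\<le>n. entry_sum m n C \<le> (\<Sum>i<e. ?r i - int t) + (\<Sum>j<f. ?s j - 1) - int e * int f"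
    unfolding tot
  proof (rule truncated_cut_le_initial_cut[OF _ _ IJ])
    fix i k :: nat assume "i \<le> k"
    show "k < m \<Longrightarrow> ?r k - int t \<le> ?r i - int t"
      using assms(1,3) \<open>i \<le> k\<close> by (simp add: nonincreasing_vec_def)
    show "k < n \<Longrightarrow> ?s k - 1 \<le> ?s i - 1"
      using assms(2,4) \<open>i \<le> k\<close> unfolding nonincreasing_vec_def
      by (intro diff_right_mono) simp
  qed
  then obtain e f where ef: "e \<le> m" "f \<le> n"
    and cut: "entry_sum m n C \<le> (\<Sum>i<e. ?r i - int t) + (\<Sum>j<f. ?s j - 1) - int e * int f"
    by blast
  have "\<exists>A' C'. binary m n A' \<and> binary m n C' \<and> (\<forall>i<m. \<forall>j<n. C' i j \<le> A' i j) \<and>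
    (\<forall>i<m. row_sum n A' i = row_sum n ?a i \<and> row_sum n C' i = row_sum n C i) \<and>
    (\<forall>j<n. col_sum m A' j = col_sum m ?a j \<and> col_sum m C' j = col_sum m C j)"
    \<comment> \<open>The lower bounds \<open>?s j - 1\<close> on the column sums of
      \<open>C\<close> supply the required gap of at most 1.\<close>
    by (rule nested_pair[OF bin C]) (use rowC colC in \<open>force simp: rows cols\<close>)+
  then obtain B D where B: "binary m n B" and D: "binary m n D"
    and le: "\<And>i j. i < m \<Longrightarrow> j < n \<Longrightarrow> D i j \<le> B i j"
    and rowB: "\<And>i. i < m \<Longrightarrow> row_sum n B i = ?r i"
    and rowD: "\<And>i. i < m \<Longrightarrow> row_sum n D i = row_sum n C i"
    and colB: "\<And>j. j < n \<Longrightarrow> col_sum m B j = ?s j"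
    and colD: "\<And>j. j < n \<Longrightarrow> col_sum m D j = col_sum m C j"
    using rows cols by auto
  \<comment> \<open>\<open>A'\<close> has the margins of \<open>A\<close> but may differ from it. As
    \<open>D\<close> lies below \<open>B\<close>, the set \<open>P\<close> is the support of
    \<open>B - D\<close>, so its row counts are at most \<open>t\<close> and its column counts at
    most 1.\<close>
  define A' where "A' = mat m n (\<lambda>(i, j). nat (B i j))"
  define P where "P = {(i, j). i < m \<and> j < n \<and> B i j = 1 \<and> D i j = 0}"
  have A'B: "int (A' $$ (i, j)) = B i j" if "i < m" "j < n" for i j
    using binaryD[OF B that] that by (auto simp: A'_def)
  have A': "A' \<in> zero_one_class R S"
    unfolding zero_one_class_iff[OF R S]
  proof (intro conjI)
    show "A' \<in> carrier_mat m n" by (simp add: A'_def)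
    show "binary m n (\<lambda>i j. int (A' $$ (i, j)))"
      using B A'B by (simp add: binary_def)
    show "\<forall>i<m. row_sum n (\<lambda>i j. int (A' $$ (i, j))) i = int (R $ i)"
      using rowB A'B by (simp add: row_sum_def)
    show "\<forall>j<n. col_sum m (\<lambda>i j. int (A' $$ (i, j))) j = int (S $ j)"
      using colB A'B by (simp add: col_sum_def)
  qed
  have sub: "P \<subseteq> {..<m} \<times> {..<n}" by (auto simp: P_def)
  note marg = card_fibres_eq_margins[OF sub]
  have BDP: "of_bool ((i, j) \<in> P) = B i j - D i j" if "i < m" "j < n" for i j
    using binaryD[OF B that] binaryD[OF D that] le[OF that] that by (auto simp: P_def)
  have rowP: "int (card {j. (i, j) \<in> P}) = ?r i - row_sum n C i" if "i < m" for i
  proof -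
    have "row_sum n B i - row_sum n D i = (\<Sum>j<n. of_bool ((i, j) \<in> P))"
      using BDP that by (simp add: row_sum_def sum_subtractf)
    then show ?thesis using marg(1)[of i] rowB rowD that by (simp add: row_sum_def)
  qed
  have colP: "int (card {i. (i, j) \<in> P}) = ?s j - col_sum m C j" if "j < n" for j
  proof -
    have "col_sum m B j - col_sum m D j = (\<Sum>i<m. of_bool ((i, j) \<in> P))"
      using BDP that by (simp add: col_sum_def sum_subtractf)
    then show ?thesis using marg(2)[of j] colB colD that by (simp add: col_sum_def)
  qed
  have "int (card P) = (\<Sum>i<m. int (card {j. (i, j) \<in> P}))"
    using marg(1) marg(3) by (simp add: entry_sum_def)
  also have "\<dots> = (\<Sum>i<m. ?r i) - entry_sum m n C"
    by (simp add: rowP entry_sum_def sum_subtractf)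
  finally have "struct_entry R S e f + int t * int e + int f \<le> int (card P)"
    using cut unfolding struct_entry_alt[OF R ef(1)] by simp
  moreover have "P \<in> term_selections t A'"
  proof -
    have "P \<subseteq> {(i, j). i < m \<and> j < n \<and> A' $$ (i, j) = 1}"
      by (auto simp: P_def A'_def)
    moreover have "card {i. (i, j) \<in> P} \<le> 1" if "j < n" for j
      using colP[OF that] colC[OF that] by linarith
    moreover have "card {j. (i, j) \<in> P} \<le> t" if "i < m" for i
      using rowP[OF that] rowC[OF that] by linarith
    moreover have "dim_row A' = m" "dim_col A' = n" by (auto simp: A'_def)
    ultimately show ?thesis by (simp add: term_selections_def)
  qed
  ultimately show ?thesis using A' ef by blast
qed

theorem theorem4p3:
  fixes R S :: "nat vec" and m n t :: nat
  assumes "R \<in> carrier_vec m" and "S \<in> carrier_vec n"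
    and "nonincreasing_vec R" and "nonincreasing_vec S"
    and "zero_one_class R S \<noteq> {}"
    and "t > 0"
  shows "int (max_term_rank t R S) =
    Min {struct_entry R S e f + int t * int e + int f | e f. e \<le> m \<and> f \<le> n}"
proof -
  let ?v = "\<lambda>e f. struct_entry R S e f + int t * int e + int f"
  let ?V = "{?v e f | e f. e \<le> m \<and> f \<le> n}"
  have "?V = (\<lambda>(e, f). ?v e f) ` ({..m} \<times> {..n})" by auto
  then have fin: "finite ?V" by simp
  have "max_term_rank t R S \<in> term_rank t ` zero_one_class R S"
    unfolding max_term_rank_def using assms(5) by (intro Max_in finite_term_rank_image) auto
  then obtain A where A: "A \<in> zero_one_class R S" "max_term_rank t R S = term_rank t A"
    by blast
  have "term_rank t A \<in> card ` term_selections t A"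
    unfolding term_rank_def using empty_in_term_selections
    by (intro Max_in finite_imageI finite_term_selections) auto
  then obtain P where P: "P \<in> term_selections t A" "max_term_rank t R S = card P"
    using A by auto
  have upper: "int (max_term_rank t R S) \<le> ?v e f" if "e \<le> m" "f \<le> n" for e f
    using term_selection_card_le[OF assms(1,2) A(1) P(1) that] P(2) by simp
  obtain B Q e f where B: "B \<in> zero_one_class R S" and Q: "Q \<in> term_selections t B"
    and ef: "e \<le> m" "f \<le> n" and le: "?v e f \<le> int (card Q)"
    using term_selection_attaining[OF assms(1-4) A(1)] by blast
  \<comment> \<open>The chain
    \<open>?v e f \<le> card Q \<le> max_term_rank t R S \<le> ?v e f\<close> closes, so this one
    pair \<open>e\<close>, \<open>f\<close> attains the minimum.\<close>
  have "card Q \<le> term_rank t B"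
    unfolding term_rank_def using Q by (intro Max_ge finite_imageI finite_term_selections) auto
  also have "\<dots> \<le> max_term_rank t R S"
    unfolding max_term_rank_def using B by (intro Max_ge finite_term_rank_image) auto
  finally have "int (max_term_rank t R S) = ?v e f"
    using le upper[OF ef] by simp
  moreover have "Min ?V = ?v e f"
    using ef upper calculation by (intro Min_eqI[OF fin]) auto
  ultimately show ?thesis by simp
qed

end
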